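(* Let $m\ge 2$ and $n\ge1$ be integers and let $\mathcal{A}\in\mathbb{S}_{m,n}$ be a $Z$-tensor. Then $$\lambda_{\min}(\mathcal{A})=\max\{\lambda\in\mathbb{R}:\ \mathbb{F}(\mathcal{A}-\lambda\mathcal{I})\ne\emptyset\}.$$
   Context: $\mathbb{S}_{m,n}$ is the set of real symmetric tensors $\mathcal{A}=(a_{i_1\dots i_m})$ of order $m$ and dimension $n$ (indices in $[n]=\{1,\dots,n\}$). $\mathcal{I}$ is the diagonal tensor of order $m$ and dimension $n$ with all diagonal elements $1$ (and off-diagonal elements $0$). A $Z$-tensor is a tensor of the form $s\mathcal{I}-\mathcal{D}$ with $s\ge0$ a scalar and $\mathcal{D}$ an entrywise nonnegative tensor. A real number $\lambda$ is an $H$-eigenvalue of $\mathcal{A}$ if there is $x\in\mathbb{R}^n\setminus\{0\}$ with $\sum_{i_2,\dots,i_m}a_{ii_2\dots i_m}x_{i_2}\cdots x_{i_m}=\lambda x_i^{m-1}$ for all $i\in[n]$. $\lambda_{\min}(\mathcal{A})$ is the minimum $H$-eigenvalue of $\mathcal{A}$. $\mathscr{D}_n^m$ is the set of $\vec{i}=(i_1,\dots,i_m)$ with $1\le i_1\le\cdots\le i_m\le n$ not all equal; $j\in\vec{i}$ means $j\in\{i_1,\dots,i_m\}$. For $\vec{i}\in\mathscr{D}_n^m$ with distinct values $j_1<\dots<j_l$ of multiplicities $\alpha=(\alpha_1,\dots,\alpha_l)$, $c(\vec{i})=\prod_{k=1}^l\binom{m-1}{\alpha-e_k}^{\alpha_k}$,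 where $e_k$ is the $k$-th unit vector of $\mathbb{R}^l$ and $\binom{m-1}{\beta}=\frac{(m-1)!}{\beta_1!\cdots\beta_l!}$. For $\alpha\in\mathbb{R}^m_+$ with $\sum_k\alpha_k=1$, $\mathbb{K}^{(m)}_\alpha=\{(x,z)\in\mathbb{R}^m_+\times\mathbb{R}: x_1^{\alpha_1}\cdots x_m^{\alpha_m}\ge|z|\}$; $e$ is the all-ones vector. For $\mathcal{C}=(c_{i_1\dots i_m})\in\mathbb{S}_{m,n}$ (with $c_{\vec{i}}=c_{i_1\dots i_m}$ its entries, not to be confused with the constants $c(\vec{i})$), $\mathbb{F}(\mathcal{C})$ is the set of families of reals $(d^{\vec{i}}_j)_{\vec{i}\in\mathscr{D}_n^m, j\in\vec{i}}$ such that $c_{jj\dots j}\ge\sum_{\vec{i}\in\mathscr{D}_n^m: j\in\vec{i}}d^{\vec{i}}_j$ for all $j\in[n]$ and $(d^{\vec{i}}_{i_1},\dots,d^{\vec{i}}_{i_m},c(\vec{i})^{1/m}c_{\vec{i}})\in\mathbb{K}^{(m)}_{\frac1m e}$ for all $\vec{i}\in\mathscr{D}_n^m$. *)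

theory Defs
  imports "HOL-Analysis.Analysis" "HOL-Combinatorics.Permutations"
begin

text \<open>
  The dimension \<open>n\<close> is \<open>CARD('n)\<close>; a finite linearly ordered type \<open>'n\<close> plays the role of the
  index set \<open>{1,\<dots>,n}\<close> (a type is never empty, so \<open>n \<ge> 1\<close>).  A multi-index
  \<open>(i\<^sub>1,\<dots>,i\<^sub>m)\<close> is a list of length \<open>m\<close> over \<open>'n\<close>, and a tensor of order \<open>m\<close> is a real
  function on lists, of which only the values at lists of length \<open>m\<close> matter.
\<close>

type_synonym 'n tensor = "'n list \<Rightarrow> real"

definition symmetric_tensor :: "nat \<Rightarrow> 'n tensor \<Rightarrow> bool" where
  "symmetric_tensor m A \<longleftrightarrow>
     (\<forall>is p. length is = m \<and> p permutes {..<m} \<longrightarrow> A (permute_list p is) = A is)"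

definition id_tensor :: "nat \<Rightarrow> 'n tensor" where
  "id_tensor m is = (if \<exists>j. is = replicate m j then 1 else 0)"

definition Z_tensor :: "nat \<Rightarrow> 'n tensor \<Rightarrow> bool" where
  "Z_tensor m A \<longleftrightarrow>
     (\<exists>s D. s \<ge> 0 \<and> (\<forall>is. length is = m \<longrightarrow> D is \<ge> 0) \<and>
            (\<forall>is. length is = m \<longrightarrow> A is = s * id_tensor m is - D is))"

definition H_eigenvalue :: "nat \<Rightarrow> 'n::finite tensor \<Rightarrow> real \<Rightarrow> bool" where
  "H_eigenvalue m A l \<longleftrightarrow>
     (\<exists>x :: real ^ 'n. x \<noteq> 0 \<and>
        (\<forall>i. (\<Sum>is | length is = m - 1. A (i # is) * (\<Prod>j\<leftarrow>is. x $ j)) = l * (x $ i) ^ (m - 1)))"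

definition is_minimum :: "real \<Rightarrow> real set \<Rightarrow> bool" where
  "is_minimum a S \<longleftrightarrow> a \<in> S \<and> (\<forall>b\<in>S. a \<le> b)"

definition is_maximum :: "real \<Rightarrow> real set \<Rightarrow> bool" where
  "is_maximum a S \<longleftrightarrow> a \<in> S \<and> (\<forall>b\<in>S. b \<le> a)"

text \<open>Unspecified if there is no smallest H-eigenvalue.\<close>

definition lambda_min :: "nat \<Rightarrow> 'n::finite tensor \<Rightarrow> real" where
  "lambda_min m A = (THE l. is_minimum l {l. H_eigenvalue m A l})"

definition offdiag_indices :: "nat \<Rightarrow> 'n::linorder list set" where
  "offdiag_indices m = {is. length is = m \<and> sorted is \<and> \<not> (\<exists>j. is = replicate m j)}"

text \<open>
  The multiplicity vector \<open>\<alpha>\<close> of \<open>is\<close> is \<open>count_list is\<close> on \<open>set is\<close>, and \<open>\<beta> = \<alpha> - e\<^sub>k\<close> below is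
  never negative there, so the truncated subtraction is harmless.
\<close>

definition multinomial :: "'n set \<Rightarrow> nat \<Rightarrow> ('n \<Rightarrow> nat) \<Rightarrow> real" where
  "multinomial J N \<beta> = fact N / (\<Prod>j\<in>J. fact (\<beta> j))"

definition c_const :: "nat \<Rightarrow> 'n list \<Rightarrow> real" where
  "c_const m is =
     (\<Prod>k\<in>set is.
        multinomial (set is) (m - 1) (\<lambda>j. count_list is j - (if j = k then 1 else 0))
          ^ count_list is k)"

text \<open>
  The cone for a weight vector \<open>\<alpha>\<close>, with vectors given as lists.  Since \<open>0 powr 0 = 0\<close>, a zero
  weight is treated separately so that \<open>x\<^sup>0 = 1\<close>.
\<close>

definition power_cone :: "real list \<Rightarrow> (real list \<times> real) set" where
  "power_cone \<alpha> =
     {(x, z). length x = length \<alpha> \<and> (\<forall>t\<in>set x. t \<ge> 0) \<and>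
        (\<Prod>k<length \<alpha>. if \<alpha> ! k = 0 then 1 else (x ! k) powr (\<alpha> ! k)) \<ge> \<bar>z\<bar>}"

text \<open>
  Families are indexed by pairs with \<open>is \<in> offdiag_indices m\<close> and \<open>j \<in> set is\<close> only, hence the
  extensional function spaces.
\<close>

definition F_set :: "nat \<Rightarrow> 'n::{finite,linorder} tensor \<Rightarrow> ('n list \<Rightarrow> 'n \<Rightarrow> real) set" where
  "F_set m C =
     {d \<in> Pi\<^sub>E (offdiag_indices m) (\<lambda>is. Pi\<^sub>E (set is) (\<lambda>_. UNIV)).
        (\<forall>j. C (replicate m j) \<ge> (\<Sum>is | is \<in> offdiag_indices m \<and> j \<in> set is. d is j)) \<and>
        (\<forall>is\<in>offdiag_indices m.
           (map (d is) is, c_const m is powr (1 / real m) * C is)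
             \<in> power_cone (replicate m (1 / real m)))}"

end

theory Submission
  imports Defs "HOL-Combinatorics.Multiset_Permutations"
begin

text \<open>
  Both sides equal \<open>\<mu>\<close>, the minimum of the form \<open>A x\<^sup>m\<close> over the nonnegative vectors with
  \<open>\<Sum>j. x j ^ m = 1\<close>.  A \<open>Z\<close>-tensor is used through the sign of its off-diagonal entries, which are
  nonpositive.

  \<^emph>\<open>Eigenvalues.\<close>  At a minimizer \<open>y\<close> the partial derivatives of \<open>A x\<^sup>m - \<mu> \<Sum>j. x j ^ m\<close> vanish in the
  directions with \<open>y i > 0\<close> and are nonnegative in those with \<open>y i = 0\<close>; the sign of the off-diagonal
  entries forces them to vanish there too.  By symmetry these derivatives are \<open>m\<close> times the residuals
  of the eigenvalue equation, so \<open>\<mu>\<close> is an H-eigenvalue.  Conversely, replacing an eigenvector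
  \<open>v\<close> for \<open>\<lambda>\<close> by \<open>\<bar>v\<bar>\<close> turns the eigenvalue equations into inequalities; multiplied by
  the numbers \<open>\<bar>v j\<bar>\<close> and added up, they give \<open>A \<bar>v\<bar>\<^sup>m \<le> \<lambda> \<Sum>j. \<bar>v j\<bar> ^ m\<close>, whence \<open>\<mu> \<le> \<lambda>\<close>.

  \<^emph>\<open>Families bound from below.\<close>  Group the terms of the form by their sorted multi-index.  A family in
  \<open>F_set m C\<close> distributes the diagonal of \<open>C\<close> over the off-diagonal multi-indices, and \<open>c_const\<close> is
  exactly the constant for which the weighted inequality between arithmetic and geometric mean makes
  each block nonnegative on the nonnegative orthant (\<open>weighted_am_gm\<close>,
  \<open>certificate_imp_form_nonneg\<close>).  For \<open>C = A - \<lambda>I\<close>, evaluation at the minimizer gives \<open>\<lambda> \<le> \<mu>\<close>.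

  \<^emph>\<open>The bound is attained.\<close>  If the minimizer \<open>y\<close> is strictly positive, choosing the family so that
  every block attains equality in this inequality at \<open>y\<close> satisfies the diagonal constraints by the
  eigenvalue equation (\<open>certificate_of_positive_eigenvector\<close>).  In general \<open>y\<close> may have zeros;
  subtracting \<open>1/(k+1)\<close> from every entry of \<open>A\<close> makes the minimizer positive, and the resulting
  families are bounded by the diagonal, so a subsequence converges to a family for \<open>A - \<mu>I\<close>
  (\<open>certificate_at_minimum\<close>).
\<close>

section \<open>Homogeneous forms of symmetric tensors\<close>

definition form :: "nat \<Rightarrow> 'n::finite tensor \<Rightarrow> ('n \<Rightarrow> real) \<Rightarrow> real" where
  "form m A x = (\<Sum>is | length is = m. A is * (\<Prod>j\<leftarrow>is. x j))"

text \<open>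
  Symmetry without reference to permutations, so that it passes to the slices \<open>\<lambda>is. A (j # is)\<close>.
\<close>

definition mset_invariant :: "nat \<Rightarrow> 'n tensor \<Rightarrow> bool" where
  "mset_invariant m A \<longleftrightarrow> (\<forall>xs ys. length xs = m \<longrightarrow> mset xs = mset ys \<longrightarrow> A xs = A ys)"

definition offdiag_nonpos :: "nat \<Rightarrow> 'n tensor \<Rightarrow> bool" where
  "offdiag_nonpos m A \<longleftrightarrow> (\<forall>is. length is = m \<longrightarrow> (\<nexists>j. is = replicate m j) \<longrightarrow> A is \<le> 0)"

lemma finite_lists_of_length [simp]: "finite {is :: 'n::finite list. length is = m}"
  using finite_lists_length_eq[of "UNIV :: 'n set" m] by simp

lemma symmetric_tensor_imp_mset_invariant:
  assumes "symmetric_tensor m A"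
  shows "mset_invariant m A"
  unfolding mset_invariant_def
proof (intro allI impI)
  fix xs ys :: "'a list"
  assume len: "length xs = m" and eq: "mset xs = mset ys"
  obtain p where p: "p permutes {..<length ys}" "permute_list p ys = xs"
    using mset_eq_permutation[OF eq] .
  have "length ys = m"
    using len eq by (metis mset_eq_length)
  then show "A xs = A ys"
    using assms p unfolding symmetric_tensor_def by blast
qed

lemma Z_tensor_imp_offdiag_nonpos:
  assumes "Z_tensor m A"
  shows "offdiag_nonpos m A"
  using assms unfolding Z_tensor_def offdiag_nonpos_def id_tensor_def by fastforce

lemma mset_invariant_Cons: "mset_invariant (Suc m) A \<Longrightarrow> mset_invariant m (\<lambda>is. A (j # is))"
  unfolding mset_invariant_def by auto

lemma eq_replicate_if_mset_eq: "mset xs = mset (replicate m j) \<Longrightarrow> xs = replicate m j"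
  using mset_eq_length[of xs "replicate m j"] mset_eq_setD[of xs "replicate m j"]
  by (intro replicate_eqI) auto

lemma mset_invariant_shift:
  assumes "mset_invariant m A"
  shows "mset_invariant m (\<lambda>is. A is - l * id_tensor m is)"
proof -
  have "xs = replicate m j \<longleftrightarrow> ys = replicate m j" if "mset xs = mset ys" for xs ys :: "'a list" and j
    using eq_replicate_if_mset_eq[of xs m j] eq_replicate_if_mset_eq[of ys m j] that by auto
  then have id_eq: "id_tensor m xs = id_tensor m ys" if "mset xs = mset ys" for xs ys :: "'a list"
    using that unfolding id_tensor_def by (intro if_cong ex_cong1) blast+
  show ?thesis
    unfolding mset_invariant_def
  proof (intro allI impI)
    fix xs ys :: "'a list"
    assume *: "length xs = m" "mset xs = mset ys"
    then have "A xs = A ys"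
      using assms unfolding mset_invariant_def by blast
    then show "A xs - l * id_tensor m xs = A ys - l * id_tensor m ys"
      using id_eq[OF *(2)] by simp
  qed
qed

lemma form_0 [simp]: "form 0 A x = A []"
  unfolding form_def by simp

text \<open>
  Splitting off the first index makes properties of forms accessible to induction on the order.
\<close>

lemma form_Suc:
  "form (Suc m) A x = (\<Sum>j\<in>UNIV. x j * form m (\<lambda>is. A (j # is)) x)"
proof -
  have "form (Suc m) A x =
      (\<Sum>(j, is)\<in>UNIV \<times> {is. length is = m}. A (j # is) * (\<Prod>i\<leftarrow>j # is. x i))"
    unfolding form_def
    by (rule sum.reindex_bij_witness[where j = "\<lambda>is. (hd is, tl is)" and i = "\<lambda>(j, is). j # is"])
      (auto simp: length_Suc_conv)
  also have "\<dots> = (\<Sum>j\<in>UNIV. \<Sum>is | length is = m. A (j # is) * (\<Prod>i\<leftarrow>j # is. x i))"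
    by (rule sum.cartesian_product[symmetric])
  also have "\<dots> = (\<Sum>j\<in>UNIV. x j * form m (\<lambda>is. A (j # is)) x)"
    unfolding form_def by (simp add: sum_distrib_left mult_ac)
  finally show ?thesis .
qed

lemma form_diff: "form m (\<lambda>is. A is - B is) x = form m A x - form m B x"
  unfolding form_def by (simp add: left_diff_distrib sum_subtractf)

lemma form_scale_tensor: "form m (\<lambda>is. c * A is) x = c * form m A x"
  unfolding form_def by (simp add: sum_distrib_left mult_ac)

lemma form_homogeneous: "form m A (\<lambda>j. c * x j) = c ^ m * form m A x"
proof (induction m arbitrary: A)
  case (Suc m)
  show ?case
    unfolding form_Suc Suc by (simp add: sum_distrib_left mult_ac)
qed simp

lemma form_id_tensor:
  fixes x :: "'n::finite \<Rightarrow> real"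
  assumes "m > 0"
  shows "form m (id_tensor m) x = (\<Sum>j\<in>UNIV. x j ^ m)"
proof -
  have "form m (id_tensor m) x =
      (\<Sum>is\<in>range (replicate m). id_tensor m is * (\<Prod>j\<leftarrow>is. x j))"
    unfolding form_def by (rule sum.mono_neutral_right) (auto simp: id_tensor_def)
  also have "\<dots> = (\<Sum>j\<in>UNIV. id_tensor m (replicate m j) * (\<Prod>i\<leftarrow>replicate m j. x i))"
    using assms by (subst sum.reindex) (auto simp: inj_on_def replicate_eq_replicate)
  also have "\<dots> = (\<Sum>j\<in>UNIV. x j ^ m)"
    by (rule sum.cong) (auto simp: id_tensor_def)
  finally show ?thesis .
qed

text \<open>
  By the product rule for \<open>form_Suc\<close>, differentiating \<open>\<Sum>j. x j * form m (\<lambda>is. A (j # is)) x\<close> gives the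
  slice at \<open>i\<close> from the factors \<open>x j\<close>, and \<open>m\<close> further copies of it from the slices by induction.
\<close>

lemma form_has_derivative_axis:
  assumes "mset_invariant m A"
  shows "((\<lambda>t. form m A (x(i := x i + t))) has_real_derivative
           real m * form (m - 1) (\<lambda>is. A (i # is)) x) (at 0)"
  using assms
proof (induction m arbitrary: A)
  case (Suc m)
  let ?x = "\<lambda>t. x(i := x i + t)"
  let ?G = "\<lambda>j. form (m - 1) (\<lambda>is. A (j # i # is)) x"
  have coord: "((\<lambda>t. ?x t j) has_real_derivative (if j = i then 1 else 0)) (at 0)" for j
    by (auto intro!: derivative_eq_intros)
  have "((\<lambda>t. form (Suc m) A (?x t)) has_real_derivative
      (\<Sum>j\<in>UNIV. (if j = i then 1 else 0) * form m (\<lambda>is. A (j # is)) x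
        + x j * (real m * ?G j))) (at 0)"
    unfolding form_Suc
    by (rule DERIV_sum, rule derivative_eq_intros, rule coord,
        rule Suc.IH, rule mset_invariant_Cons, rule Suc.prems) (simp add: mult.commute)
  also have "(\<Sum>j\<in>UNIV. (if j = i then 1 else 0) * form m (\<lambda>is. A (j # is)) x
        + x j * (real m * ?G j)) =
      form m (\<lambda>is. A (i # is)) x + real m * (\<Sum>j\<in>UNIV. x j * ?G j)"
    by (simp add: sum.distrib sum_distrib_left mult_ac if_distrib[of "\<lambda>c. c * _"] cong: if_cong)
  also have "real m * (\<Sum>j\<in>UNIV. x j * ?G j) = real m * form m (\<lambda>is. A (i # is)) x"
  proof (cases m)
    case (Suc k)
    \<comment> \<open>Symmetry in the first two indices turns slicing at \<open>j\<close>, then at \<open>i\<close>, into slicing the slice at \<open>i\<close>.\<close>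
    have "form k (\<lambda>is. A (j # i # is)) x = form k (\<lambda>is. A (i # j # is)) x" for j
      unfolding form_def
    proof (rule sum.cong)
      fix "is" :: "'a list" assume "is \<in> {is. length is = k}"
      then have "A (j # i # is) = A (i # j # is)"
        using Suc.prems \<open>m = Suc k\<close> unfolding mset_invariant_def by (auto simp: add_mset_commute)
      then show "A (j # i # is) * (\<Prod>j\<leftarrow>is. x j) = A (i # j # is) * (\<Prod>j\<leftarrow>is. x j)"
        by simp
    qed simp
    then show ?thesis
      using Suc by (simp add: form_Suc)
  qed simp
  finally show ?case
    by (simp add: algebra_simps)
qed simp

section \<open>The smallest H-eigenvalue as a minimum over the nonnegative orthant\<close>

lemma coordinate_le_1:
  fixes x :: "'n::finite \<Rightarrow> real"
  assumes "m > 0" and "\<And>j. 0 \<le> x j" and "(\<Sum>j\<in>UNIV. x j ^ m) = 1"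
  shows "x j \<le> 1"
proof (rule ccontr)
  assume "\<not> x j \<le> 1"
  then have "1 < x j ^ m"
    using assms(1) by (simp add: one_less_power)
  also have "\<dots> \<le> (\<Sum>j\<in>UNIV. x j ^ m)"
    using assms(2) by (intro member_le_sum) auto
  finally show False
    using assms(3) by simp
qed

lemma compact_nonneg_unit_sphere:
  assumes "m > 0"
  shows "compact {x :: real ^ 'n. (\<forall>j. 0 \<le> x $ j) \<and> (\<Sum>j\<in>UNIV. (x $ j) ^ m) = 1}" (is "compact ?S")
proof -
  have "bounded ?S"
  proof (rule boundedI)
    fix x assume x: "x \<in> ?S"
    have "norm (x $ j) \<le> 1" for j
      using x coordinate_le_1[OF assms, of "($) x" j] by simp
    then have "(\<Sum>j\<in>UNIV. norm (x $ j)) \<le> (\<Sum>j\<in>(UNIV :: 'n set). 1)"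
      by (intro sum_mono) auto
    then show "norm x \<le> CARD('n)"
      using norm_le_l1_cart[of x] by simp
  qed
  moreover have "closed ?S"
  proof -
    have "?S = (\<Inter>j. {x. 0 \<le> x $ j}) \<inter> {x. (\<Sum>j\<in>UNIV. (x $ j) ^ m) = 1}"
      by auto
    moreover have "closed ((\<Inter>j. {x :: real ^ 'n. 0 \<le> x $ j}) \<inter> {x. (\<Sum>j\<in>UNIV. (x $ j) ^ m) = 1})"
      by (intro closed_Int closed_INT ballI closed_Collect_le closed_Collect_eq continuous_intros)
    ultimately show ?thesis
      by simp
  qed
  ultimately show ?thesis
    by (simp add: compact_eq_bounded_closed)
qed

text \<open>
  The minimality condition is stated for all nonnegative vectors, by homogeneity, to spare every
  later use the normalization.
\<close>

definition minimizer :: "nat \<Rightarrow> 'n::finite tensor \<Rightarrow> ('n \<Rightarrow> real) \<Rightarrow> bool" where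
  "minimizer m A y \<longleftrightarrow>
     (\<forall>j. 0 \<le> y j) \<and> (\<Sum>j\<in>UNIV. y j ^ m) = 1 \<and>
     (\<forall>x. (\<forall>j. 0 \<le> x j) \<longrightarrow> form m A y * (\<Sum>j\<in>UNIV. x j ^ m) \<le> form m A x)"

lemma minimizer_exists:
  fixes A :: "'n::finite tensor"
  assumes "m > 0"
  shows "\<exists>y. minimizer m A y"
proof -
  let ?S = "{x :: real ^ 'n. (\<forall>j. 0 \<le> x $ j) \<and> (\<Sum>j\<in>UNIV. (x $ j) ^ m) = 1}"
  have "axis (undefined :: 'n) (1 :: real) \<in> ?S"
  proof -
    have "(\<Sum>j\<in>UNIV. (axis (undefined :: 'n) (1::real) $ j) ^ m) = (\<Sum>j\<in>UNIV. if j = (undefined::'n) then 1 else 0)"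
      using assms by (intro sum.cong) (simp_all add: axis_def)
    then show ?thesis
      by (simp add: axis_def)
  qed
  then have "?S \<noteq> {}"
    by blast
  moreover have "continuous_on ?S (\<lambda>x. form m A (($) x))"
  proof -
    have "continuous_on ?S (\<lambda>x. \<Prod>j\<leftarrow>is. x $ j)" for "is"
      by (induction "is") (auto intro!: continuous_intros)
    then show ?thesis
      unfolding form_def by (intro continuous_intros)
  qed
  ultimately obtain v where v: "v \<in> ?S" and
      min: "\<And>x. x \<in> ?S \<Longrightarrow> form m A (($) v) \<le> form m A (($) x)"
    using continuous_attains_inf[OF compact_nonneg_unit_sphere[OF assms], of "\<lambda>x. form m A (($) x)"]
    by blast
  have "form m A (($) v) * (\<Sum>j\<in>UNIV. x j ^ m) \<le> form m A x" if x: "\<forall>j. 0 \<le> x j" for x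
  proof (cases "\<forall>j. x j = 0")
    case True
    then have "x = (\<lambda>j. 0 * x j)"
      by auto
    then have "form m A x = 0 ^ m * form m A x"
      by (metis form_homogeneous)
    then have "form m A x = 0"
      using assms by (simp add: power_0_left)
    then show ?thesis
      using True assms by (simp add: power_0_left)
  next
    case False
    define s where "s = (\<Sum>j\<in>UNIV. x j ^ m)"
    obtain j where "x j > 0"
      using False x by (auto simp: less_eq_real_def)
    then have "s > 0"
      unfolding s_def using x by (intro sum_pos2[of _ j]) auto
    define c where "c = root m s"
    have c: "c > 0" "c ^ m = s"
      using \<open>s > 0\<close> assms by (auto simp: c_def)
    let ?w = "\<chi> j. inverse c * x j"
    have "?w \<in> ?S"
      using x c \<open>s > 0\<close> assms
      by (auto simp: power_mult_distrib simp flip: sum_distrib_left s_def)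
        (simp add: power_inverse)
    moreover have "($) ?w = (\<lambda>j. inverse c * x j)"
      by (simp add: fun_eq_iff)
    ultimately have "form m A (($) v) \<le> form m A (\<lambda>j. inverse c * x j)"
      using min[of ?w] by simp
    also have "\<dots> = inverse c ^ m * form m A x"
      by (rule form_homogeneous)
    also have "\<dots> = form m A x / s"
      using c by (simp add: power_inverse divide_inverse mult.commute)
    finally show ?thesis
      using \<open>s > 0\<close> by (simp add: s_def field_simps)
  qed
  then have "minimizer m A (($) v)"
    unfolding minimizer_def using v by simp
  then show ?thesis
    by blast
qed

text \<open>
  The diagonal entry of row \<open>i\<close> may have either sign, but it is multiplied by a power of \<open>y i = 0\<close>.
\<close>

lemma slice_term_nonpos:
  assumes "m \<ge> 2" and off: "offdiag_nonpos m A" and y: "\<And>j. 0 \<le> y j" and "y i = 0"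
    and len: "length is = m - 1"
  shows "A (i # is) * (\<Prod>j\<leftarrow>is. y j) \<le> 0"
proof (cases "i \<in> set is")
  case True
  then have "0 \<in> set (map y is)"
    using \<open>y i = 0\<close> by force
  then have "(\<Prod>j\<leftarrow>is. y j) = 0"
    by (simp only: prod_list_zero_iff)
  then show ?thesis
    by simp
next
  case False
  have "\<nexists>j. i # is = replicate m j"
    using False \<open>m \<ge> 2\<close> by (auto simp: Cons_replicate_eq)
  then have "A (i # is) \<le> 0"
    using off len assms(1) unfolding offdiag_nonpos_def by auto
  moreover have "0 \<le> (\<Prod>j\<leftarrow>is. y j)"
    using y by (intro prod_list_nonneg) auto
  ultimately show ?thesis
    by (rule mult_nonpos_nonneg)
qed

text \<open>
  First-order optimality on the nonnegative orthant.  The function \<open>g\<close> below is nonnegative wherever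
  \<open>y + t e\<^sub>i\<close> stays in the orthant and vanishes at \<open>t = 0\<close>; its derivative there is \<open>m\<close> times the residual
  of equation \<open>i\<close>.
\<close>

lemma minimizer_eigen_equation:
  fixes A :: "'n::finite tensor"
  assumes "m \<ge> 2" and sym: "mset_invariant m A" and off: "offdiag_nonpos m A"
    and y: "minimizer m A y"
  shows "form (m - 1) (\<lambda>is. A (i # is)) y = form m A y * y i ^ (m - 1)"
proof -
  let ?mu = "form m A y"
  let ?Q = "form (m - 1) (\<lambda>is. A (i # is)) y"
  define g where "g = (\<lambda>t. form m (\<lambda>is. A is - ?mu * id_tensor m is) (y(i := y i + t)))"
  have g: "g t = form m A (y(i := y i + t)) - ?mu * (\<Sum>j\<in>UNIV. (y(i := y i + t)) j ^ m)" for t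
    using assms(1) by (simp add: g_def form_diff form_scale_tensor form_id_tensor)
  have nonneg: "0 \<le> g t" if "- y i \<le> t" for t
  proof -
    have "\<forall>j. 0 \<le> (y(i := y i + t)) j"
      using y that unfolding minimizer_def by simp
    then have "?mu * (\<Sum>j\<in>UNIV. (y(i := y i + t)) j ^ m) \<le> form m A (y(i := y i + t))"
      using y unfolding minimizer_def by blast
    then show ?thesis
      unfolding g by (rule iffD2[OF diff_ge_0_iff_ge])
  qed
  have g0: "g 0 = 0"
    using y unfolding g minimizer_def by simp
  have "form (m - 1) (\<lambda>is. id_tensor m (i # is)) y = y i ^ (m - 1)"
  proof -
    have "form (m - 1) (\<lambda>is. id_tensor m (i # is)) y =
        (\<Sum>is\<in>{replicate (m - 1) i}. id_tensor m (i # is) * (\<Prod>j\<leftarrow>is. y j))"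
      unfolding form_def
      using assms(1) by (intro sum.mono_neutral_right) (auto simp: id_tensor_def Cons_replicate_eq)
    then show ?thesis
      using assms(1) by (auto simp: id_tensor_def Cons_replicate_eq)
  qed
  moreover have "mset_invariant m (\<lambda>is. A is - ?mu * id_tensor m is)"
    using sym by (rule mset_invariant_shift)
  ultimately have deriv: "(g has_real_derivative real m * (?Q - ?mu * y i ^ (m - 1))) (at 0)"
    using form_has_derivative_axis[of m "\<lambda>is. A is - ?mu * id_tensor m is" y i]
    unfolding g_def by (simp add: form_diff form_scale_tensor)
  show ?thesis
  proof (cases "y i = 0")
    case False
    moreover have "0 \<le> y i"
      using y unfolding minimizer_def by blast
    ultimately have "0 < y i"
      by simp
    then have "real m * (?Q - ?mu * y i ^ (m - 1)) = 0"
      using nonneg g0 by (intro DERIV_local_min[OF deriv, of "y i"]) auto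
    then show ?thesis
      using assms(1) by simp
  next
    case True
    \<comment> \<open>Only the one-sided condition \<open>g' 0 \<ge> 0\<close> is available; the opposite sign comes from the entries of \<open>A\<close>.\<close>
    have "?Q \<le> 0"
      unfolding form_def
    proof (rule sum_nonpos)
      fix "is" :: "'n list" assume "is": "is \<in> {is. length is = m - 1}"
      then show "A (i # is) * (\<Prod>j\<leftarrow>is. y j) \<le> 0"
        using assms(1) off True y by (intro slice_term_nonpos) (auto simp: minimizer_def)
    qed
    moreover have "\<not> real m * (?Q - ?mu * y i ^ (m - 1)) < 0"
    proof
      assume "real m * (?Q - ?mu * y i ^ (m - 1)) < 0"
      then obtain e where "e > 0" "\<And>h. 0 < h \<Longrightarrow> h < e \<Longrightarrow> g h < g 0"
        using DERIV_neg_dec_right[OF deriv] by auto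
      then have "g (e / 2) < 0"
        using g0 by simp
      then show False
        using nonneg[of "e / 2"] \<open>e > 0\<close> True by simp
    qed
    ultimately show ?thesis
      using True assms(1) by (simp add: power_0_left mult_less_0_iff)
  qed
qed

lemma H_eigenvalue_minimum:
  fixes A :: "'n::finite tensor"
  assumes "m \<ge> 2" and "mset_invariant m A" and "offdiag_nonpos m A" and y: "minimizer m A y"
  shows "H_eigenvalue m A (form m A y)"
proof -
  have "(\<chi> j. y j) \<noteq> 0"
  proof
    assume "(\<chi> j. y j) = 0"
    then have "y j = 0" for j
      by (metis vec_lambda_beta zero_index)
    then show False
      using y assms(1) unfolding minimizer_def by (simp add: power_0_left)
  qed
  moreover have "($) (\<chi> j. y j) = y"
    by (simp add: fun_eq_iff)
  ultimately show ?thesis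
    using minimizer_eigen_equation[OF assms] unfolding H_eigenvalue_def form_def
    by (intro exI[of _ "\<chi> j. y j"]) simp
qed

text \<open>
  Moving the diagonal entry of row \<open>i\<close> to the other side before taking absolute values keeps the
  argument independent of its sign: the remaining entries are nonpositive, so the triangle inequality
  points in the right direction for \<open>\<bar>v\<bar>\<close>.
\<close>

lemma H_eigenvalue_lower_bound:
  fixes A :: "'n::finite tensor"
  assumes "m \<ge> 2" and off: "offdiag_nonpos m A" and y: "minimizer m A y" and "H_eigenvalue m A l"
  shows "form m A y \<le> l"
proof -
  obtain v :: "real ^ 'n" where "v \<noteq> 0" and
      eq: "\<And>i. form (m - 1) (\<lambda>is. A (i # is)) (($) v) = l * (v $ i) ^ (m - 1)"
    using assms(4) unfolding H_eigenvalue_def form_def by blast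
  let ?z = "\<lambda>j. \<bar>v $ j\<bar>"
  have bound: "form (m - 1) (\<lambda>is. A (i # is)) ?z \<le> l * ?z i ^ (m - 1)" for i
  proof -
    let ?D = "replicate (m - 1) i"
    let ?L = "{is :: 'n list. length is = m - 1}"
    have split: "form (m - 1) (\<lambda>is. A (i # is)) x = A (i # ?D) * x i ^ (m - 1) +
        (\<Sum>is\<in>?L - {?D}. A (i # is) * (\<Prod>j\<leftarrow>is. x j))" for x
      unfolding form_def by (subst sum.remove[of _ ?D]) auto
    have neg: "A (i # is) \<le> 0" if "is \<in> ?L - {?D}" for "is"
      using off that assms(1) unfolding offdiag_nonpos_def by (auto simp: Cons_replicate_eq)
    have "- (l - A (i # ?D)) * ?z i ^ (m - 1) \<le> \<bar>l - A (i # ?D)\<bar> * ?z i ^ (m - 1)"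
      by (intro mult_right_mono) auto
    also have "\<dots> = \<bar>(l - A (i # ?D)) * (v $ i) ^ (m - 1)\<bar>"
      by (simp only: abs_mult power_abs)
    also have "(l - A (i # ?D)) * (v $ i) ^ (m - 1) = (\<Sum>is\<in>?L - {?D}. A (i # is) * (\<Prod>j\<leftarrow>is. v $ j))"
      using eq[of i] unfolding split by (simp only: left_diff_distrib)
    also have "\<bar>\<dots>\<bar> \<le> (\<Sum>is\<in>?L - {?D}. \<bar>A (i # is) * (\<Prod>j\<leftarrow>is. v $ j)\<bar>)"
      by (rule sum_abs)
    also have "\<dots> = - (\<Sum>is\<in>?L - {?D}. A (i # is) * (\<Prod>j\<leftarrow>is. ?z j))"
    proof -
      have "\<bar>\<Prod>j\<leftarrow>is. v $ j\<bar> = (\<Prod>j\<leftarrow>is. ?z j)" for "is"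
        by (induction "is") (auto simp: abs_mult)
      then have "\<bar>A (i # is) * (\<Prod>j\<leftarrow>is. v $ j)\<bar> = - (A (i # is) * (\<Prod>j\<leftarrow>is. ?z j))"
        if "is \<in> ?L - {?D}" for "is"
        using neg[OF that] by (simp add: abs_mult)
      then show ?thesis
        unfolding sum_negf[symmetric] by (intro sum.cong refl)
    qed
    finally have "- (l - A (i # ?D)) * ?z i ^ (m - 1) \<le> - (\<Sum>is\<in>?L - {?D}. A (i # is) * (\<Prod>j\<leftarrow>is. ?z j))" .
    then show ?thesis
      unfolding split by (simp add: algebra_simps)
  qed
  have "form m A y * (\<Sum>j\<in>UNIV. ?z j ^ m) \<le> form m A ?z"
    using y unfolding minimizer_def by simp
  also have "\<dots> \<le> (\<Sum>i\<in>UNIV. ?z i * (l * ?z i ^ (m - 1)))"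
    using assms(1) form_Suc[of "m - 1" A ?z] bound by (auto intro!: sum_mono mult_left_mono)
  also have "\<dots> = l * (\<Sum>j\<in>UNIV. ?z j ^ m)"
    using assms(1) by (cases m) (auto simp: sum_distrib_left mult_ac)
  finally have "form m A y * (\<Sum>j\<in>UNIV. ?z j ^ m) \<le> l * (\<Sum>j\<in>UNIV. ?z j ^ m)" .
  moreover have "0 < (\<Sum>j\<in>UNIV. ?z j ^ m)"
  proof -
    obtain j where "v $ j \<noteq> 0"
      using \<open>v \<noteq> 0\<close> by (metis vec_eq_iff zero_index)
    then show ?thesis
      by (intro sum_pos2[of _ j]) auto
  qed
  ultimately show ?thesis
    by simp
qed

section \<open>Grouping the terms of a form by their multi-index\<close>

text \<open>
  The number of ways to order the entries of \<open>is\<close> that remain after one \<open>j\<close> is taken out; that is the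
  multinomial coefficient \<open>binom (m - 1) (\<alpha> - e\<^sub>j)\<close> occurring in \<open>c_const\<close>.
\<close>

definition weight :: "'n list \<Rightarrow> 'n \<Rightarrow> real" where
  "weight is j = real (card (permutations_of_multiset (mset is - {#j#})))"

lemma weight_pos: "0 < weight is j"
  unfolding weight_def by (simp add: card_gt_0_iff)

text \<open>
  This proportionality to the multiplicities is what makes the weights fit the inequality between
  arithmetic and geometric mean taken over the \<open>m\<close> positions of the multi-index.
\<close>

lemma weight_proportional:
  assumes "j \<in> set is"
  shows "weight is j =
    real (card (permutations_of_multiset (mset is))) / real (length is) * real (count_list is j)"
  using real_card_permutations_of_multiset_remove[of j "mset is"] assms
  unfolding weight_def by (simp add: count_mset)

lemma weight_eq_multinomial:
  assumes "length is = m" "j \<in> set is"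
  shows "weight is j =
    multinomial (set is) (m - 1) (\<lambda>i. count_list is i - (if i = j then 1 else 0))"
proof -
  let ?M = "mset is - {#j#}"
  have "j \<in># mset is"
    using assms by simp
  then have size: "size ?M = m - 1"
    using assms by (simp add: size_Diff_submset)
  have "(\<Prod>i\<in>set_mset ?M. fact (count ?M i)) = (\<Prod>i\<in>set is. fact (count ?M i) :: real)"
  proof (rule prod.mono_neutral_left)
    show "set_mset ?M \<subseteq> set is"
      by (auto dest: in_diffD)
    show "\<forall>i\<in>set is - set_mset ?M. fact (count ?M i) = (1 :: real)"
    proof
      fix i assume "i \<in> set is - set_mset ?M"
      then have "count ?M i = 0"
        by (simp only: Diff_iff not_in_iff)
      then show "fact (count ?M i) = (1 :: real)"
        by (simp only: fact_0)
    qed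
  qed simp
  also have "\<dots> = (\<Prod>i\<in>set is. fact (count_list is i - (if i = j then 1 else 0)))"
    by (intro prod.cong) (auto simp: count_mset)
  finally have "(\<Prod>i\<in>set_mset ?M. fact (count ?M i)) =
      (\<Prod>i\<in>set is. fact (count_list is i - (if i = j then 1 else 0)) :: real)" .
  moreover have "weight is j * (\<Prod>i\<in>set_mset ?M. fact (count ?M i)) = fact (m - 1)"
    using arg_cong[OF card_permutations_of_multiset_aux[of ?M], of real] size
    unfolding weight_def by (simp add: of_nat_prod)
  moreover have "(\<Prod>i\<in>set is. fact (count_list is i - (if i = j then 1 else 0)) :: real) \<noteq> 0"
    by simp
  ultimately show ?thesis
    unfolding multinomial_def by (simp add: field_simps)
qed

lemma prod_list_eq_prod_count:
  fixes f :: "'a \<Rightarrow> 'b::comm_monoid_mult"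
  shows "(\<Prod>j\<leftarrow>is. f j) = (\<Prod>j\<in>set is. f j ^ count_list is j)"
  using image_prod_mset_multiplicity[of f "mset is"]
  by (simp add: count_mset flip: mset_map prod_mset_prod_list)

lemma prod_list_nth:
  fixes f :: "'a \<Rightarrow> 'b::comm_monoid_mult"
  shows "(\<Prod>j\<leftarrow>is. f j) = (\<Prod>k<length is. f (is ! k))"
  by (induction "is" rule: rev_induct) (simp_all add: nth_append mult.commute)

lemma sum_list_eq_sum_count:
  fixes f :: "'a \<Rightarrow> real"
  assumes "finite J" "set is \<subseteq> J"
  shows "(\<Sum>j\<leftarrow>is. f j) = (\<Sum>j\<in>J. real (count_list is j) * f j)"
  using assms(2)
proof (induction "is")
  case (Cons i "is")
  have "(\<Sum>j\<in>J. real (count_list (i # is) j) * f j) =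
      (\<Sum>j\<in>J. real (count_list is j) * f j + (if i = j then f j else 0))"
    by (rule sum.cong) (auto simp: algebra_simps)
  then show ?case
    using Cons assms(1) by (simp add: sum.distrib)
qed simp

lemma c_const_eq_prod_weight:
  assumes "length is = m"
  shows "c_const m is = (\<Prod>j\<leftarrow>is. weight is j)"
  unfolding c_const_def prod_list_eq_prod_count
  by (rule prod.cong) (simp_all add: weight_eq_multinomial[OF assms])

lemma finite_offdiag_indices [simp]:
  "finite (offdiag_indices m :: 'n::{finite,linorder} list set)"
  by (rule finite_subset[OF _ finite_lists_of_length[of m]]) (auto simp: offdiag_indices_def)

text \<open>
  The terms of the slice at \<open>j\<close> are grouped by the sorted list \<open>sort (j # is)\<close>; by symmetry all terms of
  a group agree, and the groups have the sizes counted by \<open>weight\<close>.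
\<close>

lemma slice_by_multi_index:
  fixes A :: "'n::{finite,linorder} tensor"
  assumes "m > 0" and sym: "mset_invariant m A"
  shows "x j * form (m - 1) (\<lambda>is. A (j # is)) x = A (replicate m j) * x j ^ m +
    (\<Sum>is | is \<in> offdiag_indices m \<and> j \<in> set is. weight is j * (A is * (\<Prod>i\<leftarrow>is. x i)))"
proof -
  define h where "h = (\<lambda>is. A is * (\<Prod>i\<leftarrow>is. x i))"
  have h: "h xs = h ys" if "mset xs = mset ys" "length xs = m" for xs ys
  proof -
    have "prod_mset (mset (map x xs)) = prod_mset (mset (map x ys))"
      using that by simp
    moreover have "A xs = A ys"
      using sym that unfolding mset_invariant_def by blast
    ultimately show ?thesis
      unfolding h_def by (simp only: prod_mset_prod_list)
  qed
  let ?S = "{is :: 'n list. length is = m - 1}"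
  let ?O = "{is. is \<in> offdiag_indices m \<and> j \<in> set is}"
  let ?T = "insert (replicate m j) ?O"
  have "x j * form (m - 1) (\<lambda>is. A (j # is)) x = (\<Sum>is\<in>?S. h (j # is))"
    unfolding form_def h_def by (simp add: sum_distrib_left mult_ac)
  also have "\<dots> = (\<Sum>js\<in>?T. \<Sum>is\<in>{is. is \<in> ?S \<and> sort (j # is) = js}. h (j # is))"
  proof (rule sum.group[symmetric])
    show "(\<lambda>is. sort (j # is)) ` ?S \<subseteq> ?T"
    proof
      fix js assume "js \<in> (\<lambda>is. sort (j # is)) ` ?S"
      then obtain "is" where js: "js = sort (j # is)" and "length is = m - 1"
        by blast
      then have "length js = m" "sorted js" "j \<in> set js"
        unfolding js using assms(1) by (auto simp del: sort_key_simps simp: length_sort)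
      moreover have "i = j" if "js = replicate m i" for i
        using that \<open>j \<in> set js\<close> by auto
      ultimately show "js \<in> ?T"
        by (auto simp: offdiag_indices_def)
    qed
  qed auto
  also have "\<dots> = (\<Sum>js\<in>?T. weight js j * h js)"
  proof (rule sum.cong)
    fix js assume "js \<in> ?T"
    then have js: "length js = m" "sorted js" "j \<in> set js"
      using assms(1) by (auto simp: offdiag_indices_def)
    have fibre: "{is. is \<in> ?S \<and> sort (j # is) = js} = permutations_of_multiset (mset js - {#j#})"
    proof -
      have "sort (j # is) = js \<longleftrightarrow> mset (j # is) = mset js" for "is"
        using js(2) by (metis mset_sort properties_for_sort)
      also have "mset (j # is) = mset js \<longleftrightarrow> mset is = mset js - {#j#}" for "is"
      proof -
        have "mset js = add_mset j (mset js - {#j#})"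
          using js(3) by simp
        then show ?thesis
          by (metis add_mset_add_mset_same_iff mset.simps(2))
      qed
      finally have "sort (j # is) = js \<longleftrightarrow> mset is = mset js - {#j#}" for "is" .
      moreover have "length is = m - 1" if "mset is = mset js - {#j#}" for "is"
        using arg_cong[OF that, of size] js by (simp add: size_Diff_submset)
      ultimately show ?thesis
        unfolding permutations_of_multiset_def by blast
    qed
    have "h (j # is) = h js" if "is \<in> {is. is \<in> ?S \<and> sort (j # is) = js}" for "is"
      using that assms(1) by (intro h) (auto simp del: sort_key_simps)
    then show "(\<Sum>is\<in>{is. is \<in> ?S \<and> sort (j # is) = js}. h (j # is)) = weight js j * h js"
      unfolding weight_def fibre by simp
  qed simp
  also have "\<dots> = weight (replicate m j) j * h (replicate m j) + (\<Sum>js\<in>?O. weight js j * h js)"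
    by (rule sum.insert) (auto simp: offdiag_indices_def)
  also have "weight (replicate m j) j = 1"
  proof -
    have "mset (replicate m j) - {#j#} = mset (replicate (m - 1) j)"
      using assms(1) by (cases m) auto
    then have "permutations_of_multiset (mset (replicate m j) - {#j#}) = {replicate (m - 1) j}"
      unfolding permutations_of_multiset_def using eq_replicate_if_mset_eq[of _ "m - 1" j] by auto
    then show ?thesis
      unfolding weight_def by simp
  qed
  also have "h (replicate m j) = A (replicate m j) * x j ^ m"
    unfolding h_def by simp
  finally show ?thesis
    unfolding h_def by simp
qed

section \<open>Certificates and nonnegativity of the form\<close>

lemma power_cone_uniform_iff:
  assumes "m > 0"
  shows "(xs, z) \<in> power_cone (replicate m (1 / real m)) \<longleftrightarrow>
    length xs = m \<and> (\<forall>t\<in>set xs. 0 \<le> t) \<and> \<bar>z\<bar> ^ m \<le> prod_list xs"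
proof -
  have "(\<bar>z\<bar> \<le> (\<Prod>k<m. if replicate m (1 / real m) ! k = 0 then 1
            else (xs ! k) powr (replicate m (1 / real m) ! k))) \<longleftrightarrow> \<bar>z\<bar> ^ m \<le> prod_list xs"
    if len: "length xs = m" and nonneg: "\<forall>t\<in>set xs. 0 \<le> t"
  proof -
    have P: "0 \<le> prod_list xs"
      using nonneg by (simp add: prod_list_nonneg)
    have "(\<Prod>k<m. if replicate m (1 / real m) ! k = 0 then 1
            else (xs ! k) powr (replicate m (1 / real m) ! k)) = (\<Prod>k<m. (xs ! k) powr (1 / real m))"
      using assms by (intro prod.cong) auto
    also have "\<dots> = prod_list xs powr (1 / real m)"
      using len prod_list_nth[of "\<lambda>t. t" xs] by (simp add: prod_powr_distrib)
    also have "\<dots> = root m (prod_list xs)"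
      using assms P by (simp add: root_powr_inverse)
    finally show ?thesis
      using assms P by (metis abs_ge_zero real_root_le_iff real_root_power_cancel)
  qed
  then show ?thesis
    unfolding power_cone_def by auto
qed

text \<open>
  The conditions of \<open>F_set\<close> with roots cleared and without the extensionality requirement on the
  family, which makes them polynomial inequalities and so stable under limits.
\<close>

definition certificate ::
    "nat \<Rightarrow> 'n::{finite,linorder} tensor \<Rightarrow> ('n list \<Rightarrow> 'n \<Rightarrow> real) \<Rightarrow> bool" where
  "certificate m C d \<longleftrightarrow>
     (\<forall>j. (\<Sum>is | is \<in> offdiag_indices m \<and> j \<in> set is. d is j) \<le> C (replicate m j)) \<and>
     (\<forall>is\<in>offdiag_indices m.
        (\<forall>j\<in>set is. 0 \<le> d is j) \<and> c_const m is * \<bar>C is\<bar> ^ m \<le> (\<Prod>j\<leftarrow>is. d is j))"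

lemma F_set_nonempty_iff:
  fixes C :: "'n::{finite,linorder} tensor"
  assumes "m > 0"
  shows "F_set m C \<noteq> {} \<longleftrightarrow> (\<exists>d. certificate m C d)"
proof -
  have cone: "(map (d is) is, c_const m is powr (1 / real m) * C is)
        \<in> power_cone (replicate m (1 / real m)) \<longleftrightarrow>
      (\<forall>j\<in>set is. 0 \<le> d is j) \<and> c_const m is * \<bar>C is\<bar> ^ m \<le> (\<Prod>j\<leftarrow>is. d is j)"
    if "is \<in> offdiag_indices m" for "is" and d :: "'n list \<Rightarrow> 'n \<Rightarrow> real"
  proof -
    have len: "length is = m"
      using that by (simp add: offdiag_indices_def)
    have "0 < (\<Prod>j\<leftarrow>is. weight is j)"
      unfolding prod_list_eq_prod_count by (intro prod_pos zero_less_power ballI weight_pos)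
    then have pos: "0 < c_const m is"
      using len by (simp add: c_const_eq_prod_weight)
    then have "\<bar>c_const m is powr (1 / real m) * C is\<bar> ^ m = c_const m is * \<bar>C is\<bar> ^ m"
      using assms by (simp add: abs_mult power_mult_distrib powr_power)
    then show ?thesis
      using len unfolding power_cone_uniform_iff[OF assms] by simp
  qed
  have "certificate m C d" if "d \<in> F_set m C" for d
    using that cone unfolding F_set_def certificate_def by auto
  moreover have "F_set m C \<noteq> {}" if d: "certificate m C d" for d
  proof -
    define d' where "d' = restrict (\<lambda>is. restrict (d is) (set is)) (offdiag_indices m)"
    have d': "d' is j = d is j" if "is \<in> offdiag_indices m" "j \<in> set is" for "is" j
      using that by (simp add: d'_def)
    have "d' \<in> F_set m C"
      unfolding F_set_def
    proof (intro CollectI conjI ballI allI)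
      show "d' \<in> Pi\<^sub>E (offdiag_indices m) (\<lambda>is. Pi\<^sub>E (set is) (\<lambda>_. UNIV))"
        by (auto simp: d'_def)
      show "(\<Sum>is | is \<in> offdiag_indices m \<and> j \<in> set is. d' is j) \<le> C (replicate m j)" for j
      proof -
        have "(\<Sum>is | is \<in> offdiag_indices m \<and> j \<in> set is. d' is j) =
            (\<Sum>is | is \<in> offdiag_indices m \<and> j \<in> set is. d is j)"
          by (rule sum.cong) (auto simp: d')
        then show ?thesis
          using d unfolding certificate_def by simp
      qed
      fix "is" :: "'n list" assume "is": "is \<in> offdiag_indices m"
      then have map: "map (d' is) is = map (d is) is"
        by (simp add: d')
      show "(map (d' is) is, c_const m is powr (1 / real m) * C is)
          \<in> power_cone (replicate m (1 / real m))"
        unfolding map using cone[OF "is", of d] d "is" unfolding certificate_def by simp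
    qed
    then show ?thesis
      by blast
  qed
  ultimately show ?thesis
    by blast
qed

text \<open>
  The inequality between arithmetic and geometric mean is applied to the numbers
  \<open>t j = d j * y j ^ m / weight is j\<close>, one for each position of \<open>is\<close>.  Since the weights are
  proportional to the multiplicities, the arithmetic mean over positions is the weighted sum over
  distinct indices; since \<open>c_const\<close> is the product of the weights over the positions, the geometric
  mean is at least \<open>u * (\<Prod>j\<leftarrow>is. y j)\<close>.
\<close>

lemma weighted_am_gm:
  fixes d y :: "'n \<Rightarrow> real"
  assumes "m > 0" and len: "length is = m"
    and d: "\<And>j. j \<in> set is \<Longrightarrow> 0 \<le> d j" and y: "\<And>j. 0 \<le> y j" and "0 \<le> u"
    and c: "c_const m is * u ^ m \<le> (\<Prod>j\<leftarrow>is. d j)"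
  shows "(\<Sum>j\<in>set is. weight is j) * (u * (\<Prod>j\<leftarrow>is. y j)) \<le> (\<Sum>j\<in>set is. d j * y j ^ m)"
proof -
  define K where "K = real (card (permutations_of_multiset (mset is)))"
  define t where "t = (\<lambda>j. d j * y j ^ m / weight is j)"
  have weight: "weight is j = K / real m * real (count_list is j)" if "j \<in> set is" for j
    using weight_proportional[OF that] len unfolding K_def by simp
  have count: "(\<Sum>j\<in>set is. real (count_list is j) * f j) = (\<Sum>k<m. f (is ! k))" for f :: "'n \<Rightarrow> real"
    using sum_list_eq_sum_count[of "set is" "is" f] len
    by (simp add: sum_list_sum_nth atLeast0LessThan)
  have t: "0 \<le> t j" if "j \<in> set is" for j
    using d[OF that] y[of j] weight_pos[of "is" j] unfolding t_def by simp
  have "(\<Sum>j\<in>set is. weight is j) = K / real m * (\<Sum>j\<in>set is. real (count_list is j) * 1)"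
    by (simp add: weight sum_distrib_left)
  then have total: "(\<Sum>j\<in>set is. weight is j) = K"
    unfolding count using assms(1) by simp
  have "u * (\<Prod>j\<leftarrow>is. y j) = root m ((u * (\<Prod>j\<leftarrow>is. y j)) ^ m)"
  proof -
    have "0 \<le> u * (\<Prod>j\<leftarrow>is. y j)"
      using \<open>0 \<le> u\<close> y by (intro mult_nonneg_nonneg prod_list_nonneg) auto
    then show ?thesis
      using assms(1) by (simp only: real_root_power_cancel)
  qed
  also have "\<dots> \<le> root m (\<Prod>j\<leftarrow>is. t j)"
  proof -
    have W: "0 < (\<Prod>j\<leftarrow>is. weight is j)"
      unfolding prod_list_eq_prod_count by (intro prod_pos zero_less_power ballI weight_pos)
    have "(\<Prod>j\<leftarrow>is. t j) = (\<Prod>j\<leftarrow>is. d j) * (\<Prod>j\<leftarrow>is. y j) ^ m / (\<Prod>j\<leftarrow>is. weight is j)"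
      unfolding prod_list_eq_prod_count t_def
      by (simp add: power_divide power_mult_distrib prod_dividef prod.distrib prod_power_distrib
          mult.commute flip: power_mult)
    moreover have "(\<Prod>j\<leftarrow>is. weight is j) * u ^ m * (\<Prod>j\<leftarrow>is. y j) ^ m
        \<le> (\<Prod>j\<leftarrow>is. d j) * (\<Prod>j\<leftarrow>is. y j) ^ m"
      using c y unfolding c_const_eq_prod_weight[OF len]
      by (intro mult_right_mono zero_le_power prod_list_nonneg) auto
    ultimately have "(u * (\<Prod>j\<leftarrow>is. y j)) ^ m \<le> (\<Prod>j\<leftarrow>is. t j)"
      using W by (simp add: pos_le_divide_eq mult_ac power_mult_distrib)
    then show ?thesis
      using assms(1) by (simp add: real_root_le_iff)
  qed
  also have "\<dots> = (\<Prod>k<m. t (is ! k)) powr (1 / real m)"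
  proof -
    have "0 \<le> (\<Prod>j\<leftarrow>is. t j)"
      using t by (intro prod_list_nonneg) auto
    then show ?thesis
      using assms(1) len by (simp add: root_powr_inverse prod_list_nth)
  qed
  also have "\<dots> \<le> (\<Sum>k<m. t (is ! k) / real m)"
    using arith_geom_mean[of "{..<m}" "\<lambda>k. t (is ! k)"] t assms(1) len by auto
  finally have "u * (\<Prod>j\<leftarrow>is. y j) \<le> (\<Sum>k<m. t (is ! k)) / real m"
    by (simp add: sum_divide_distrib)
  then have "K * (u * (\<Prod>j\<leftarrow>is. y j)) \<le> K * ((\<Sum>k<m. t (is ! k)) / real m)"
    by (intro mult_left_mono) (auto simp: K_def)
  also have "\<dots> = K / real m * (\<Sum>j\<in>set is. real (count_list is j) * t j)"
    unfolding count by simp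
  also have "\<dots> = (\<Sum>j\<in>set is. weight is j * t j)"
    by (simp add: weight sum_distrib_left mult_ac)
  also have "\<dots> = (\<Sum>j\<in>set is. d j * y j ^ m)"
  proof (rule sum.cong)
    show "weight is j * t j = d j * y j ^ m" for j
      using weight_pos[of "is" j] by (simp add: t_def)
  qed simp
  finally show ?thesis
    unfolding total .
qed

text \<open>
  Each off-diagonal multi-index, together with its share \<open>d is\<close> of the diagonal, contributes a
  nonnegative block to the form, and the diagonal covers all the shares.
\<close>

lemma certificate_imp_form_nonneg:
  fixes C :: "'n::{finite,linorder} tensor"
  assumes "m > 0" and sym: "mset_invariant m C" and d: "certificate m C d" and y: "\<And>j. 0 \<le> y j"
  shows "0 \<le> form m C y"
proof -
  let ?off = "offdiag_indices m :: 'n list set"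
  let ?mon = "\<lambda>is. \<Prod>j\<leftarrow>is. y j"
  have block: "0 \<le> (\<Sum>j\<in>set is. d is j * y j ^ m + weight is j * (C is * ?mon is))"
    if "is": "is \<in> ?off" for "is"
  proof -
    have len: "length is = m"
      using "is" by (simp add: offdiag_indices_def)
    have "(\<Sum>j\<in>set is. weight is j) * (\<bar>C is\<bar> * ?mon is) \<le> (\<Sum>j\<in>set is. d is j * y j ^ m)"
      using d "is" y by (intro weighted_am_gm[OF \<open>m > 0\<close> len]) (auto simp: certificate_def)
    moreover have "(\<Sum>j\<in>set is. weight is j) * (- \<bar>C is\<bar> * ?mon is)
        \<le> (\<Sum>j\<in>set is. weight is j) * (C is * ?mon is)"
      using y
      by (intro mult_left_mono mult_right_mono sum_nonneg prod_list_nonneg less_imp_le[OF weight_pos]) auto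
    ultimately show ?thesis
      by (simp add: sum.distrib sum_distrib_right)
  qed
  have swap: "(\<Sum>j\<in>UNIV. \<Sum>is | is \<in> ?off \<and> j \<in> set is. f is j) = (\<Sum>is\<in>?off. \<Sum>j\<in>set is. f is j)"
    for f :: "'n list \<Rightarrow> 'n \<Rightarrow> real"
    using sum.swap_restrict[of UNIV ?off "\<lambda>j is. f is j" "\<lambda>j is. j \<in> set is"] by simp
  have "0 \<le> (\<Sum>is\<in>?off. \<Sum>j\<in>set is. d is j * y j ^ m + weight is j * (C is * ?mon is))"
    using block by (rule sum_nonneg)
  also have "\<dots> = (\<Sum>j\<in>UNIV. \<Sum>is | is \<in> ?off \<and> j \<in> set is.
      d is j * y j ^ m + weight is j * (C is * ?mon is))"
    by (rule swap[symmetric])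
  also have "\<dots> \<le> (\<Sum>j\<in>UNIV. y j * form (m - 1) (\<lambda>is. C (j # is)) y)"
  proof (rule sum_mono)
    fix j
    have "(\<Sum>is | is \<in> ?off \<and> j \<in> set is. d is j) * y j ^ m \<le> C (replicate m j) * y j ^ m"
      using d y by (intro mult_right_mono) (auto simp: certificate_def)
    then show "(\<Sum>is | is \<in> ?off \<and> j \<in> set is. d is j * y j ^ m + weight is j * (C is * ?mon is))
        \<le> y j * form (m - 1) (\<lambda>is. C (j # is)) y"
      unfolding slice_by_multi_index[OF assms(1) sym] by (simp add: sum.distrib sum_distrib_right)
  qed
  also have "\<dots> = form m C y"
    using form_Suc[of "m - 1" C y] assms(1) by simp
  finally show ?thesis .
qed

section \<open>Certificates from eigenvectors\<close>

text \<open>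
  The family is the one for which the numbers \<open>t j\<close> in \<open>weighted_am_gm\<close>, with \<open>u = \<bar>A is\<bar>\<close>, are all equal
  at the eigenvector.  Its shares at \<open>j\<close> then add up to the negated off-diagonal part of equation \<open>j\<close>, divided by
  \<open>y j ^ (m - 1)\<close>, so both kinds of constraints hold with equality.
\<close>

lemma certificate_of_positive_eigenvector:
  fixes A :: "'n::{finite,linorder} tensor"
  assumes "m > 0" and sym: "mset_invariant m A" and off: "offdiag_nonpos m A"
    and y: "\<And>j. 0 < y j"
    and eigen: "\<And>j. form (m - 1) (\<lambda>is. A (j # is)) y = mu * y j ^ (m - 1)"
  shows "certificate m (\<lambda>is. A is - mu * id_tensor m is)
           (\<lambda>is j. weight is j * (\<bar>A is\<bar> * (\<Prod>i\<leftarrow>is. y i)) / y j ^ m)"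
  unfolding certificate_def
proof (intro conjI allI ballI)
  fix j :: 'n
  let ?I = "{is. is \<in> offdiag_indices m \<and> j \<in> set is}"
  have "\<bar>A is\<bar> = - A is" if "is \<in> ?I" for "is"
    using off that unfolding offdiag_nonpos_def offdiag_indices_def by auto
  then have "(\<Sum>is\<in>?I. weight is j * (\<bar>A is\<bar> * (\<Prod>i\<leftarrow>is. y i)) / y j ^ m) =
      - (\<Sum>is\<in>?I. weight is j * (A is * (\<Prod>i\<leftarrow>is. y i))) / y j ^ m"
    unfolding sum_negf[symmetric] sum_divide_distrib by (intro sum.cong) auto
  also have "(\<Sum>is\<in>?I. weight is j * (A is * (\<Prod>i\<leftarrow>is. y i))) =
      y j * (mu * y j ^ (m - 1)) - A (replicate m j) * y j ^ m"
    using slice_by_multi_index[OF assms(1) sym, of y j] unfolding eigen by simp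
  also have "y j * (mu * y j ^ (m - 1)) = mu * y j ^ m"
    using assms(1) by (cases m) auto
  also have "- (mu * y j ^ m - A (replicate m j) * y j ^ m) / y j ^ m = A (replicate m j) - mu"
    using y[of j] by (simp add: field_simps)
  finally show "(\<Sum>is\<in>?I. weight is j * (\<bar>A is\<bar> * (\<Prod>i\<leftarrow>is. y i)) / y j ^ m)
      \<le> A (replicate m j) - mu * id_tensor m (replicate m j)"
    by (auto simp: id_tensor_def)
next
  fix "is" :: "'n list" and j
  assume "is \<in> offdiag_indices m" "j \<in> set is"
  show "0 \<le> weight is j * (\<bar>A is\<bar> * (\<Prod>i\<leftarrow>is. y i)) / y j ^ m"
    using y weight_pos[of "is" j]
    by (intro divide_nonneg_nonneg mult_nonneg_nonneg prod_list_nonneg) (auto simp: less_imp_le)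
next
  fix "is" :: "'n list"
  assume "is": "is \<in> offdiag_indices m"
  then have len: "length is = m" and id: "id_tensor m is = 0"
    by (auto simp: offdiag_indices_def id_tensor_def)
  let ?P = "\<Prod>i\<leftarrow>is. y i"
  have "?P > 0"
    unfolding prod_list_eq_prod_count using y by (intro prod_pos) auto
  have "(\<Prod>j\<leftarrow>is. weight is j * (\<bar>A is\<bar> * ?P) / y j ^ m) =
      (\<Prod>j\<leftarrow>is. weight is j) * (\<Prod>j\<leftarrow>is. \<bar>A is\<bar> * ?P) / ?P ^ m"
    unfolding prod_list_eq_prod_count
    by (simp add: power_divide power_mult_distrib prod_dividef prod.distrib prod_power_distrib
        mult.commute flip: power_mult)
  also have "(\<Prod>j\<leftarrow>is. \<bar>A is\<bar> * ?P) = (\<bar>A is\<bar> * ?P) ^ m"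
    using len by (simp add: map_replicate_const)
  finally show "c_const m is * \<bar>A is - mu * id_tensor m is\<bar> ^ m
      \<le> (\<Prod>j\<leftarrow>is. weight is j * (\<bar>A is\<bar> * ?P) / y j ^ m)"
    using \<open>?P > 0\<close> len id by (simp add: c_const_eq_prod_weight power_mult_distrib)
qed

text \<open>
  Nonnegativity and the diagonal constraint confine each number \<open>d k is j\<close> to an interval from \<open>0\<close> to a
  diagonal entry, so convergence of the tensors yields compactness of the families.
\<close>

lemma certificate_limit:
  fixes C :: "'n::{finite,linorder} tensor" and Cs :: "nat \<Rightarrow> 'n tensor"
  assumes d: "\<And>k. certificate m (Cs k) (d k)" and lim: "\<And>is. (\<lambda>k. Cs k is) \<longlonglongrightarrow> C is"
  shows "\<exists>e. certificate m C e"
proof -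
  let ?B = "{(is, j). is \<in> (offdiag_indices m :: 'n list set) \<and> j \<in> set is}"
  let ?f = "\<lambda>k (is, j). d k is j"
  have "?B \<subseteq> offdiag_indices m \<times> UNIV"
    by auto
  then have finite: "finite ?B"
    by (rule finite_subset) simp
  have bounded: "bounded ((\<lambda>g. g b) ` range ?f)" if b: "b \<in> ?B" for b
  proof -
    obtain "is" j where b': "b = (is, j)" "is \<in> offdiag_indices m" "j \<in> set is"
      using b by blast
    obtain M where M: "\<And>k. norm (Cs k (replicate m j)) \<le> M"
      using convergent_imp_Bseq[OF convergentI[OF lim[of "replicate m j"]]]
      unfolding Bseq_def by blast
    have "norm (d k is j) \<le> M" for k
    proof -
      have nonneg: "0 \<le> d k js j" if "js \<in> offdiag_indices m" "j \<in> set js" for js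
        using d[of k] that unfolding certificate_def by blast
      have "d k is j \<le> (\<Sum>js | js \<in> offdiag_indices m \<and> j \<in> set js. d k js j)"
        using b' nonneg by (intro member_le_sum) auto
      also have "\<dots> \<le> Cs k (replicate m j)"
        using d[of k] unfolding certificate_def by blast
      also have "\<dots> \<le> M"
        using M[of k] by simp
      finally show ?thesis
        using nonneg b' by simp
    qed
    then show ?thesis
      unfolding b' by (intro boundedI) auto
  qed
  obtain e r where r: "strict_mono (r :: nat \<Rightarrow> nat)"
      and e: "\<And>\<epsilon>. \<epsilon> > 0 \<Longrightarrow> \<forall>\<^sub>F k in sequentially. \<forall>b\<in>?B. dist (?f (r k) b) (e b) < \<epsilon>"
    using compact_lemma_general[where f = ?f and proj = "\<lambda>g. g" and unproj = "\<lambda>g. g" and basis = ?B,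
        OF finite bounded] by blast
  have conv: "(\<lambda>k. d (r k) is j) \<longlonglongrightarrow> e (is, j)" if "is \<in> offdiag_indices m" "j \<in> set is" for "is" j
  proof (rule tendstoI)
    fix \<epsilon> :: real assume "\<epsilon> > 0"
    show "\<forall>\<^sub>F k in sequentially. dist (d (r k) is j) (e (is, j)) < \<epsilon>"
      using e[OF \<open>\<epsilon> > 0\<close>] by eventually_elim (use that in auto)
  qed
  have lim_r: "(\<lambda>k. Cs (r k) is) \<longlonglongrightarrow> C is" for "is"
    using LIMSEQ_subseq_LIMSEQ[OF lim r] by (simp add: o_def)
  have prod_conv: "(\<lambda>k. \<Prod>j\<leftarrow>is. d (r k) is j) \<longlonglongrightarrow> (\<Prod>j\<leftarrow>is. e (is, j))"
    if "is \<in> offdiag_indices m" for "is"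
    unfolding prod_list_eq_prod_count using conv that by (intro tendsto_intros) auto
  have "certificate m C (\<lambda>is j. e (is, j))"
    unfolding certificate_def
  proof (intro conjI allI ballI)
    fix j
    have "(\<lambda>k. \<Sum>is | is \<in> offdiag_indices m \<and> j \<in> set is. d (r k) is j)
        \<longlonglongrightarrow> (\<Sum>is | is \<in> offdiag_indices m \<and> j \<in> set is. e (is, j))"
      using conv by (intro tendsto_sum) auto
    then show "(\<Sum>is | is \<in> offdiag_indices m \<and> j \<in> set is. e (is, j)) \<le> C (replicate m j)"
      using d by (intro LIMSEQ_le[OF _ lim_r]) (auto simp: certificate_def)
  next
    fix "is" j assume "is \<in> (offdiag_indices m :: 'n list set)" "j \<in> set is"
    then show "0 \<le> e (is, j)"
      using d by (intro LIMSEQ_le_const[OF conv]) (auto simp: certificate_def)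
  next
    fix "is" assume "is": "is \<in> (offdiag_indices m :: 'n list set)"
    have "(\<lambda>k. c_const m is * \<bar>Cs (r k) is\<bar> ^ m) \<longlonglongrightarrow> c_const m is * \<bar>C is\<bar> ^ m"
      by (intro tendsto_intros lim_r)
    then show "c_const m is * \<bar>C is\<bar> ^ m \<le> (\<Prod>j\<leftarrow>is. e (is, j))"
      using d "is" by (intro LIMSEQ_le[OF _ prod_conv]) (auto simp: certificate_def)
  qed
  then show ?thesis
    by blast
qed

text \<open>
  If \<open>y i = 0\<close>, all terms of equation \<open>i\<close> vanish, including the one with the index list \<open>(i, j, \<dots>, j)\<close> for
  an index \<open>j\<close> with \<open>y j > 0\<close>; that contradicts the strict sign of the entry.
\<close>

lemma minimizer_positive:
  fixes A :: "'n::finite tensor"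
  assumes "m \<ge> 2" and sym: "mset_invariant m A" 
    and neg: "\<And>is. length is = m \<Longrightarrow> (\<nexists>j. is = replicate m j) \<Longrightarrow> A is < 0"
    and y: "minimizer m A y"
  shows "0 < y i"
proof (rule ccontr)
  assume "\<not> 0 < y i"
  then have yi: "y i = 0"
    using y unfolding minimizer_def by (meson not_less order_antisym)
  have nonneg: "0 \<le> y j" for j
    using y unfolding minimizer_def by blast
  obtain j where "y j \<noteq> 0"
    using y assms(1) unfolding minimizer_def by (metis (no_types, lifting) sum.neutral power_0_left
        not_numeral_le_zero zero_neq_one)
  then have "0 < y j" "j \<noteq> i"
    using nonneg[of j] yi by auto
  let ?h = "\<lambda>is. A (i # is) * (\<Prod>j\<leftarrow>is. y j)"
  let ?D = "replicate (m - 1) j"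
  have "offdiag_nonpos m A"
    unfolding offdiag_nonpos_def using neg by (auto intro: less_imp_le)
  then have "form (m - 1) (\<lambda>is. A (i # is)) y = 0"
    using minimizer_eigen_equation[OF assms(1) sym _ y, of i] yi assms(1) by (simp add: power_0_left)
  then have "(\<Sum>is | length is = m - 1. ?h is) = 0"
    unfolding form_def .
  moreover have "?h is \<le> 0" if "length is = m - 1" for "is"
    using assms(1) \<open>offdiag_nonpos m A\<close> nonneg yi that by (rule slice_term_nonpos)
  ultimately have "\<forall>is\<in>{is. length is = m - 1}. - ?h is = 0"
    by (subst sum_nonneg_eq_0_iff[symmetric]) (simp_all add: sum_negf)
  then have "- ?h ?D = 0"
    by (rule bspec) simp
  moreover have "A (i # ?D) < 0"
    using \<open>j \<noteq> i\<close> assms(1) by (intro neg) (auto simp: Cons_replicate_eq)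
  ultimately show False
    using \<open>0 < y j\<close> by simp
qed

text \<open>
  The minimizers \<open>ys k\<close> of the perturbed tensors need not converge to \<open>y\<close>, but the minima \<open>mu k\<close>
  converge to the minimum for \<open>A\<close>, because the perturbation changes the form by at most \<open>N / (k + 1)\<close> on
  the normalized vectors.
\<close>

lemma certificate_at_minimum:
  fixes A :: "'n::{finite,linorder} tensor"
  assumes "m \<ge> 2" and sym: "mset_invariant m A" and off: "offdiag_nonpos m A"
    and y: "minimizer m A y"
  shows "\<exists>d. certificate m (\<lambda>is. A is - form m A y * id_tensor m is) d"
proof -
  have "m > 0"
    using assms(1) by simp
  define As where "As = (\<lambda>k is. A is - inverse (real (Suc k)))"
  define N where "N = real (card {is :: 'n list. length is = m})"
  have "\<exists>y. minimizer m (As k) y" for k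
    using assms(1) by (intro minimizer_exists) simp
  then obtain ys where ys: "\<And>k. minimizer m (As k) (ys k)"
    by metis
  define mu where "mu = (\<lambda>k. form m (As k) (ys k))"
  have sym_k: "mset_invariant m (As k)" for k
    using sym unfolding mset_invariant_def As_def by metis
  have neg: "As k is < 0" if "length is = m" "\<nexists>j. is = replicate m j" for k "is"
  proof -
    have "A is \<le> 0"
      using off that unfolding offdiag_nonpos_def by blast
    moreover have "0 < inverse (real (Suc k))"
      by simp
    ultimately show ?thesis
      unfolding As_def by linarith
  qed
  then have off_k: "offdiag_nonpos m (As k)" for k
    unfolding offdiag_nonpos_def by (auto intro: less_imp_le)
  have cert: "\<exists>d. certificate m (\<lambda>is. As k is - mu k * id_tensor m is) d" for k
  proof -
    have "0 < ys k j" for j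
      by (rule minimizer_positive[OF assms(1) sym_k neg ys])
    moreover have "form (m - 1) (\<lambda>is. As k (j # is)) (ys k) = mu k * ys k j ^ (m - 1)" for j
      unfolding mu_def by (rule minimizer_eigen_equation[OF assms(1) sym_k off_k ys])
    ultimately show ?thesis
      using certificate_of_positive_eigenvector[OF \<open>m > 0\<close> sym_k off_k] by blast
  qed
  then obtain d where d: "\<And>k. certificate m (\<lambda>is. As k is - mu k * id_tensor m is) (d k)"
    by metis
  have form_As: "form m (As k) x = form m A x - inverse (real (Suc k)) * form m (\<lambda>_. 1) x" for k x
    using form_scale_tensor[of m "inverse (real (Suc k))" "\<lambda>_. 1" x]
    unfolding As_def form_diff by simp
  have ones_nonneg: "0 \<le> form m (\<lambda>_. 1) x" if "\<And>j. 0 \<le> x j" for x :: "'n \<Rightarrow> real"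
    using that unfolding form_def by (auto intro!: sum_nonneg prod_list_nonneg)
  have ones_le: "form m (\<lambda>_. 1) x \<le> N" if "\<And>j. 0 \<le> x j" "\<And>j. x j \<le> 1" for x :: "'n \<Rightarrow> real"
  proof -
    have "0 \<le> (\<Prod>j\<leftarrow>is. x j) \<and> (\<Prod>j\<leftarrow>is. x j) \<le> 1" for "is"
      by (induction "is") (auto simp: that mult_le_one)
    then have "form m (\<lambda>_. 1) x \<le> (\<Sum>is\<in>{is :: 'n list. length is = m}. 1)"
      unfolding form_def by (intro sum_mono) simp
    then show ?thesis
      by (simp add: N_def)
  qed
  have upper: "mu k \<le> form m A y" for k
  proof -
    have "mu k \<le> form m (As k) y"
      using ys[of k] y unfolding minimizer_def mu_def by (metis mult.right_neutral)
    also have "\<dots> \<le> form m A y"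
      using ones_nonneg[of y] y unfolding form_As minimizer_def by simp
    finally show ?thesis .
  qed
  have lower: "form m A y - inverse (real (Suc k)) * N \<le> mu k" for k
  proof -
    have nonneg: "0 \<le> ys k j" and sum: "(\<Sum>j\<in>UNIV. ys k j ^ m) = 1" for j
      using ys[of k] unfolding minimizer_def by blast+
    have "form m A y \<le> form m A (ys k)"
      using y nonneg sum unfolding minimizer_def by (metis mult.right_neutral)
    moreover have "form m (\<lambda>_. 1) (ys k) \<le> N"
      using ones_le nonneg coordinate_le_1[OF \<open>m > 0\<close> nonneg sum] by blast
    then have "inverse (real (Suc k)) * form m (\<lambda>_. 1) (ys k) \<le> inverse (real (Suc k)) * N"
      by (intro mult_left_mono) auto
    ultimately show ?thesis
      unfolding mu_def form_As by linarith
  qed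
  have "mu \<longlonglongrightarrow> form m A y"
  proof (rule tendsto_sandwich)
    show "(\<lambda>k. form m A y - inverse (real (Suc k)) * N) \<longlonglongrightarrow> form m A y"
      using tendsto_diff[OF tendsto_const tendsto_mult[OF LIMSEQ_inverse_real_of_nat tendsto_const]]
      by fastforce
  qed (use upper lower in auto)
  moreover have "(\<lambda>k. As k is) \<longlonglongrightarrow> A is" for "is"
    using tendsto_diff[OF tendsto_const LIMSEQ_inverse_real_of_nat] unfolding As_def by fastforce
  ultimately have "(\<lambda>k. As k is - mu k * id_tensor m is) \<longlonglongrightarrow> A is - form m A y * id_tensor m is" for "is"
    by (intro tendsto_intros)
  then show ?thesis
    by (intro certificate_limit[OF d])
qed

theorem corollary5:
  fixes m :: nat and A :: "'n::{finite,linorder} tensor"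
  assumes "m \<ge> 2" and "symmetric_tensor m A" and "Z_tensor m A"
  shows "is_minimum (lambda_min m A) {l. H_eigenvalue m A l} \<and>
         is_maximum (lambda_min m A) {l. F_set m (\<lambda>is. A is - l * id_tensor m is) \<noteq> {}}"
proof -
  have "m > 0"
    using assms(1) by simp
  have sym: "mset_invariant m A" and off: "offdiag_nonpos m A"
    using assms symmetric_tensor_imp_mset_invariant Z_tensor_imp_offdiag_nonpos by blast+
  obtain y where y: "minimizer m A y"
    using minimizer_exists[OF \<open>m > 0\<close>] by blast
  have min: "is_minimum (form m A y) {l. H_eigenvalue m A l}"
    unfolding is_minimum_def
    using H_eigenvalue_minimum[OF assms(1) sym off y] H_eigenvalue_lower_bound[OF assms(1) off y]
    by blast
  then have lambda_min: "lambda_min m A = form m A y"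
    unfolding lambda_min_def by (rule the_equality) (use min in \<open>auto simp: is_minimum_def intro: antisym\<close>)
  have "l \<le> form m A y" if "certificate m (\<lambda>is. A is - l * id_tensor m is) d" for l d
  proof -
    have "0 \<le> form m (\<lambda>is. A is - l * id_tensor m is) y"
      using y \<open>m > 0\<close> sym
      by (intro certificate_imp_form_nonneg[OF _ _ that] mset_invariant_shift) (auto simp: minimizer_def)
    also have "\<dots> = form m A y - l"
      using y \<open>m > 0\<close> by (simp add: form_diff form_scale_tensor form_id_tensor minimizer_def)
    finally show ?thesis
      by simp
  qed
  then have "is_maximum (form m A y) {l. F_set m (\<lambda>is. A is - l * id_tensor m is) \<noteq> {}}"
    using certificate_at_minimum[OF assms(1) sym off y]
    unfolding is_maximum_def F_set_nonempty_iff[OF \<open>m > 0\<close>] by blast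
  then show ?thesis
    using min unfolding lambda_min by blast
qed

end
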